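(* Let $N_{\mathrm{fe}}\ge 2$ and $n_{\mathrm{s}}\ge 1$. For any feasible solution $(x_{n,i},\lambda_{n,i},h_n)$ to the discrete FESD problem (the constraint system defined in the context), the following hold for any $n\in\{2,\dots,N_{\mathrm{fe}}\}$: $$\bigcup_{i=1}^{n_{\mathrm{s}}}\mathcal{S}_{n-1,i}\ \cap\ \bigcup_{i=1}^{n_{\mathrm{s}}}\mathcal{I}_{n,i}\ \subseteq\ \mathcal{W}_{n-1,n_{\mathrm{s}}},$$ i.e. if for some $k$ there exist $i,j\in\{1,\dots,n_{\mathrm{s}}\}$ such that $\lambda_{n-1,i,k}>0$ and $c_k(x_{n,j})>0$, then $c_k(x_{n-1,n_{\mathrm{s}}})=0$ and $\lambda_{n-1,n_{\mathrm{s}},k}=0$; and $$\bigcup_{i=1}^{n_{\mathrm{s}}}\mathcal{I}_{n-1,i}\ \cap\ \bigcup_{i=1}^{n_{\mathrm{s}}}\mathcal{S}_{n,i}\ \subseteq\ \mathcal{W}_{n-1,n_{\mathrm{s}}},$$ i.e. if for some $k$ there exist $i,j\in\{1,\dots,n_{\mathrm{s}}\}$ such that $c_k(x_{n-1,i})>0$ and $\lambda_{n,j,k}>0$, then $c_k(x_{n-1,n_{\mathrm{s}}})=0$ and $\lambda_{n-1,n_{\mathrm{s}},k}=0$.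
   Context: Setting: $f:\mathbb{R}^{n_x}\times\mathbb{R}^{n_u}\to\mathbb{R}^{n_x}$ and $c=(c_1,\dots,c_{n_c}):\mathbb{R}^{n_x}\to\mathbb{R}^{n_c}$ are at least twice continuously differentiable, $u\in\mathbb{R}^{n_u}$ is a fixed control, $T>0$, and $\nabla c(x)\in\mathbb{R}^{n_x\times n_c}$ has columns $\nabla c_i(x)$. For vectors $a,b\in\mathbb{R}^{n_c}$, $0\le a\perp b\ge 0$ means that, for every $k$, $a_k\ge 0$, $b_k\ge 0$ and $a_kb_k=0$. A Runge-Kutta scheme with $n_{\mathrm{s}}$ stages is given by a Butcher tableau with coefficients $a_{i,j}$, weights and nodes, the last node being equal to $1$ (so the last stage point is the end of the step). Discrete FESD problem: the interval $[0,T]$ is divided into $N_{\mathrm{fe}}$ finite elements of variable lengths $h_n$ with $\sum_{n=1}^{N_{\mathrm{fe}}}h_n=T$. The unknowns are the step sizes $h_n\in\mathbb{R}$, the stage states $x_{n,i}\in\mathbb{R}^{n_x}$, the stage multipliers $\lambda_{n,i}\in\mathbb{R}^{n_c}$ (with $k$-th component $\lambda_{n,i,k}$), and the auxiliary variables below; $x_{1,0}$ is the given initial state and $x_{n,0}=x_{n-1,n_{\mathrm{s}}}$ for $n\ge 2$. A feasible solution satisfies all of the following constraints. (Runge-Kutta equations) for $n=1,\dots,N_{\mathrm{fe}}$, $i=1,\dots,n_{\mathrm{s}}$: $$x_{n,i}=x_{n,0}+h_n\sum_{j=1}^{n_{\mathrm{s}}}a_{i,j}\bigl(f(x_{n,j},u)+\nabla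 c(x_{n,j})\lambda_{n,j}\bigr),\qquad 0\le c(x_{n,i})\perp\lambda_{n,i}\ge 0.$$ (Cross-complementarity) for $i,j=1,\dots,n_{\mathrm{s}}$: $0\le c(x_{n,i})\perp\lambda_{n,j}\ge 0$ for $n=1,\dots,N_{\mathrm{fe}}$; $0\le c(x_{n-1,n_{\mathrm{s}}})\perp\lambda_{n,j}\ge 0$ for $n=2,\dots,N_{\mathrm{fe}}$; $0\le c(x_{n,i})\perp\lambda_{n-1,n_{\mathrm{s}}}\ge 0$ for $n=2,\dots,N_{\mathrm{fe}}$. (Step equilibration) for $n=2,\dots,N_{\mathrm{fe}}$, with a large constant $M>0$ and all relations understood componentwise in $\mathbb{R}^{n_c}$: set $\sigma^B_{c,n}=\sum_j c(x_{n-1,j})$, $\sigma^F_{c,n}=\sum_j c(x_{n,j})$, $\sigma^B_{\lambda,n}=\sum_j\lambda_{n-1,j}$, $\sigma^F_{\lambda,n}=\sum_j\lambda_{n,j}$ (sums over $j=1,\dots,n_{\mathrm{s}}$); there are auxiliary variables $\pi_{c,n},\pi_{\lambda,n},\nu_n$ with $\pi_{c,n}=\sigma^B_{c,n}\vee\sigma^F_{c,n}$, $\pi_{\lambda,n}=\sigma^B_{\lambda,n}\vee\sigma^F_{\lambda,n}$, $\nu_n=\pi_{c,n}\wedge\pi_{\lambda,n}$, and $-\nu_nM\le h_{n-1}-h_n\le\nu_nM$. Here, for $x,y,z\ge 0$, $z=x\vee y$ stands for the constraints $z\ge x$, $z\ge y$, $z\le x+y$, and $z=x\wedge y$ stands for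 $z\le x$, $z\le y$, $z\ge x+y-\max(x,y)$. Index sets: for $n=1,\dots,N_{\mathrm{fe}}$, $i=1,\dots,n_{\mathrm{s}}$, with $k$ ranging over $\{1,\dots,n_c\}$, $\mathcal{S}_{n,i}=\{k\mid c_k(x_{n,i})=0,\ \lambda_{n,i,k}>0\}$, $\mathcal{W}_{n,i}=\{k\mid c_k(x_{n,i})=0,\ \lambda_{n,i,k}=0\}$, $\mathcal{I}_{n,i}=\{k\mid c_k(x_{n,i})>0,\ \lambda_{n,i,k}=0\}$ (strongly active, weakly active and inactive constraints). *)

theory Defs
  imports "HOL-Analysis.Analysis"
begin

definition twice_continuously_differentiable ::
    "('a::real_normed_vector \<Rightarrow> 'b::real_normed_vector) \<Rightarrow> bool" where
  "twice_continuously_differentiable g \<longleftrightarrow>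
     (\<exists>(g' :: 'a \<Rightarrow> 'a \<Rightarrow>\<^sub>L 'b) (g'' :: 'a \<Rightarrow> 'a \<Rightarrow>\<^sub>L ('a \<Rightarrow>\<^sub>L 'b)).
        (\<forall>x. (g has_derivative blinfun_apply (g' x)) (at x)) \<and>
        (\<forall>x. (g' has_derivative blinfun_apply (g'' x)) (at x)) \<and>
        continuous_on UNIV g'')"

(* The k-th column is the gradient of the k-th component of c. *)
definition nabla :: "(real ^ 'x \<Rightarrow> real ^ 'c) \<Rightarrow> real ^ 'x \<Rightarrow> real ^ 'c ^ 'x" where
  "nabla c x = transpose (jacobian c (at x))"

(* 0 \<le> a \<bottom> b \<ge> 0 *)
definition complementary :: "real ^ 'c \<Rightarrow> real ^ 'c \<Rightarrow> bool" where
  "complementary a b \<longleftrightarrow> (\<forall>k. a $ k \<ge> 0 \<and> b $ k \<ge> 0 \<and> a $ k * b $ k = 0)"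

(* Relational encodings of "z = x \<or> y" and "z = x \<and> y" for nonnegative reals.
   The first one does not determine z. *)
definition or_rel :: "real \<Rightarrow> real \<Rightarrow> real \<Rightarrow> bool" where
  "or_rel z x y \<longleftrightarrow> z \<ge> x \<and> z \<ge> y \<and> z \<le> x + y"

definition and_rel :: "real \<Rightarrow> real \<Rightarrow> real \<Rightarrow> bool" where
  "and_rel z x y \<longleftrightarrow> z \<le> x \<and> z \<le> y \<and> z \<ge> x + y - max x y"

(* Stages are numbered 1, ..., stages; entries at other indices are irrelevant. *)
record butcher_tableau =
  stages :: nat
  coeff :: "nat \<Rightarrow> nat \<Rightarrow> real"
  weight :: "nat \<Rightarrow> real"
  node :: "nat \<Rightarrow> real"

(* In the following, X n i, L n i and h n are the stage state, stage multiplier and length of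
   finite element n = 1, ..., N; X n i is also used for i = 0, the left end point of element n. *)

definition fesd_grid :: "real \<Rightarrow> nat \<Rightarrow> (nat \<Rightarrow> real) \<Rightarrow> bool" where
  "fesd_grid T N h \<longleftrightarrow> (\<Sum>n = 1..N. h n) = T"

definition fesd_continuity ::
    "real ^ 'x \<Rightarrow> nat \<Rightarrow> nat \<Rightarrow> (nat \<Rightarrow> nat \<Rightarrow> real ^ 'x) \<Rightarrow> bool" where
  "fesd_continuity x0 s N X \<longleftrightarrow>
     X 1 0 = x0 \<and> (\<forall>n\<in>{2..N}. X n 0 = X (n - 1) s)"

definition fesd_runge_kutta ::
    "((real ^ 'x) \<times> (real ^ 'u) \<Rightarrow> real ^ 'x) \<Rightarrow> (real ^ 'x \<Rightarrow> real ^ 'c) \<Rightarrow> real ^ 'u \<Rightarrow>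
     butcher_tableau \<Rightarrow> nat \<Rightarrow> (nat \<Rightarrow> real) \<Rightarrow> (nat \<Rightarrow> nat \<Rightarrow> real ^ 'x) \<Rightarrow>
     (nat \<Rightarrow> nat \<Rightarrow> real ^ 'c) \<Rightarrow> bool" where
  "fesd_runge_kutta f c u B N h X L \<longleftrightarrow>
     (\<forall>n\<in>{1..N}. \<forall>i\<in>{1..stages B}.
        X n i = X n 0 + h n *\<^sub>R
          (\<Sum>j = 1..stages B. coeff B i j *\<^sub>R (f (X n j, u) + nabla c (X n j) *v L n j)) \<and>
        complementary (c (X n i)) (L n i))"

definition fesd_cross_complementarity ::
    "(real ^ 'x \<Rightarrow> real ^ 'c) \<Rightarrow> nat \<Rightarrow> nat \<Rightarrow>
     (nat \<Rightarrow> nat \<Rightarrow> real ^ 'x) \<Rightarrow> (nat \<Rightarrow> nat \<Rightarrow> real ^ 'c) \<Rightarrow> bool" where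
  "fesd_cross_complementarity c s N X L \<longleftrightarrow>
     (\<forall>n\<in>{1..N}. \<forall>i\<in>{1..s}. \<forall>j\<in>{1..s}. complementary (c (X n i)) (L n j)) \<and>
     (\<forall>n\<in>{2..N}. \<forall>j\<in>{1..s}. complementary (c (X (n - 1) s)) (L n j)) \<and>
     (\<forall>n\<in>{2..N}. \<forall>i\<in>{1..s}. complementary (c (X n i)) (L (n - 1) s))"

definition fesd_step_equilibration ::
    "(real ^ 'x \<Rightarrow> real ^ 'c) \<Rightarrow> real \<Rightarrow> nat \<Rightarrow> nat \<Rightarrow> (nat \<Rightarrow> real) \<Rightarrow>
     (nat \<Rightarrow> nat \<Rightarrow> real ^ 'x) \<Rightarrow> (nat \<Rightarrow> nat \<Rightarrow> real ^ 'c) \<Rightarrow>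
     (nat \<Rightarrow> real ^ 'c) \<Rightarrow> (nat \<Rightarrow> real ^ 'c) \<Rightarrow> (nat \<Rightarrow> real ^ 'c) \<Rightarrow> bool" where
  "fesd_step_equilibration c M s N h X L \<pi>c \<pi>L \<nu> \<longleftrightarrow>
     (\<forall>n\<in>{2..N}.
        let \<sigma>cB = (\<Sum>j = 1..s. c (X (n - 1) j)); \<sigma>cF = (\<Sum>j = 1..s. c (X n j));
            \<sigma>LB = (\<Sum>j = 1..s. L (n - 1) j); \<sigma>LF = (\<Sum>j = 1..s. L n j)
        in \<forall>k. or_rel (\<pi>c n $ k) (\<sigma>cB $ k) (\<sigma>cF $ k) \<and>
               or_rel (\<pi>L n $ k) (\<sigma>LB $ k) (\<sigma>LF $ k) \<and>
               and_rel (\<nu> n $ k) (\<pi>c n $ k) (\<pi>L n $ k) \<and>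
               - (\<nu> n $ k) * M \<le> h (n - 1) - h n \<and> h (n - 1) - h n \<le> \<nu> n $ k * M)"

definition fesd_feasible ::
    "((real ^ 'x) \<times> (real ^ 'u) \<Rightarrow> real ^ 'x) \<Rightarrow> (real ^ 'x \<Rightarrow> real ^ 'c) \<Rightarrow> real ^ 'u \<Rightarrow>
     real ^ 'x \<Rightarrow> real \<Rightarrow> real \<Rightarrow> butcher_tableau \<Rightarrow> nat \<Rightarrow>
     (nat \<Rightarrow> real) \<Rightarrow> (nat \<Rightarrow> nat \<Rightarrow> real ^ 'x) \<Rightarrow> (nat \<Rightarrow> nat \<Rightarrow> real ^ 'c) \<Rightarrow>
     (nat \<Rightarrow> real ^ 'c) \<Rightarrow> (nat \<Rightarrow> real ^ 'c) \<Rightarrow> (nat \<Rightarrow> real ^ 'c) \<Rightarrow> bool" where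
  "fesd_feasible f c u x0 T M B N h X L \<pi>c \<pi>L \<nu> \<longleftrightarrow>
     fesd_grid T N h \<and>
     fesd_continuity x0 (stages B) N X \<and>
     fesd_runge_kutta f c u B N h X L \<and>
     fesd_cross_complementarity c (stages B) N X L \<and>
     fesd_step_equilibration c M (stages B) N h X L \<pi>c \<pi>L \<nu>"

definition strongly_active ::
    "(real ^ 'x \<Rightarrow> real ^ 'c) \<Rightarrow> (nat \<Rightarrow> nat \<Rightarrow> real ^ 'x) \<Rightarrow> (nat \<Rightarrow> nat \<Rightarrow> real ^ 'c) \<Rightarrow>
     nat \<Rightarrow> nat \<Rightarrow> 'c set" where
  "strongly_active c X L n i = {k. c (X n i) $ k = 0 \<and> L n i $ k > 0}"

definition weakly_active ::
    "(real ^ 'x \<Rightarrow> real ^ 'c) \<Rightarrow> (nat \<Rightarrow> nat \<Rightarrow> real ^ 'x) \<Rightarrow> (nat \<Rightarrow> nat \<Rightarrow> real ^ 'c) \<Rightarrow>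
     nat \<Rightarrow> nat \<Rightarrow> 'c set" where
  "weakly_active c X L n i = {k. c (X n i) $ k = 0 \<and> L n i $ k = 0}"

definition inactive ::
    "(real ^ 'x \<Rightarrow> real ^ 'c) \<Rightarrow> (nat \<Rightarrow> nat \<Rightarrow> real ^ 'x) \<Rightarrow> (nat \<Rightarrow> nat \<Rightarrow> real ^ 'c) \<Rightarrow>
     nat \<Rightarrow> nat \<Rightarrow> 'c set" where
  "inactive c X L n i = {k. c (X n i) $ k > 0 \<and> L n i $ k = 0}"

end

theory Submission
  imports Defs
begin

text \<open>The complementarity conditions couple the junction values \<open>c (X (n - 1) s)\<close> and \<open>L (n - 1) s\<close>
  of the last stage \<open>s\<close> with all stages of both neighbouring elements.
  A positive multiplier in either element forces component \<open>k\<close> of the former to vanish,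
  and a positive constraint value in either element that of the latter.\<close>

lemma complementary_left_eq_0:
  "complementary a b \<Longrightarrow> b $ k > 0 \<Longrightarrow> a $ k = 0"
  unfolding complementary_def by (metis less_irrefl mult_eq_0_iff)

lemma complementary_right_eq_0:
  "complementary a b \<Longrightarrow> a $ k > 0 \<Longrightarrow> b $ k = 0"
  unfolding complementary_def by (metis less_irrefl mult_eq_0_iff)

theorem proposition3:
  fixes f :: "(real ^ 'x) \<times> (real ^ 'u) \<Rightarrow> real ^ 'x"
    and c :: "real ^ 'x \<Rightarrow> real ^ 'c"
    and u :: "real ^ 'u"
    and x0 :: "real ^ 'x"
    and T M :: real
    and B :: butcher_tableau
    and N n :: nat
    and h :: "nat \<Rightarrow> real"
    and X :: "nat \<Rightarrow> nat \<Rightarrow> real ^ 'x"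
    and L :: "nat \<Rightarrow> nat \<Rightarrow> real ^ 'c"
    and \<pi>c \<pi>L \<nu> :: "nat \<Rightarrow> real ^ 'c"
  assumes "twice_continuously_differentiable f"
    and "twice_continuously_differentiable c"
    and "T > 0" and "M > 0"
    and "stages B \<ge> 1" and "node B (stages B) = 1"
    and "N \<ge> 2"
    and "fesd_feasible f c u x0 T M B N h X L \<pi>c \<pi>L \<nu>"
    and "n \<in> {2..N}"
  shows "(\<Union>i\<in>{1..stages B}. strongly_active c X L (n - 1) i) \<inter>
           (\<Union>i\<in>{1..stages B}. inactive c X L n i)
         \<subseteq> weakly_active c X L (n - 1) (stages B) \<and>
         (\<forall>k. (\<exists>i\<in>{1..stages B}. \<exists>j\<in>{1..stages B}.
                 L (n - 1) i $ k > 0 \<and> c (X n j) $ k > 0) \<longrightarrow>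
              c (X (n - 1) (stages B)) $ k = 0 \<and> L (n - 1) (stages B) $ k = 0) \<and>
         (\<Union>i\<in>{1..stages B}. inactive c X L (n - 1) i) \<inter>
           (\<Union>i\<in>{1..stages B}. strongly_active c X L n i)
         \<subseteq> weakly_active c X L (n - 1) (stages B) \<and>
         (\<forall>k. (\<exists>i\<in>{1..stages B}. \<exists>j\<in>{1..stages B}.
                 c (X (n - 1) i) $ k > 0 \<and> L n j $ k > 0) \<longrightarrow>
              c (X (n - 1) (stages B)) $ k = 0 \<and> L (n - 1) (stages B) $ k = 0)"
proof -
  let ?s = "stages B"
  have cross: "fesd_cross_complementarity c ?s N X L"
    using assms(8) unfolding fesd_feasible_def by blast
  \<comment> \<open>There is at least one stage, so the junction values sit at a genuine stage
    index; and \<open>n\<close> is at least 2, so element \<open>n - 1\<close> has its own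
    complementarity conditions.\<close>
  have s: "?s \<in> {1..?s}" and n: "n - 1 \<in> {1..N}"
    using assms(5,9) by auto
  have within: "complementary (c (X (n - 1) i)) (L (n - 1) j)"
    if "i \<in> {1..?s}" "j \<in> {1..?s}" for i j
    using cross n that unfolding fesd_cross_complementarity_def by blast
  have forward: "complementary (c (X (n - 1) ?s)) (L n j)" if "j \<in> {1..?s}" for j
    using cross assms(9) that unfolding fesd_cross_complementarity_def by blast
  have backward: "complementary (c (X n j)) (L (n - 1) ?s)" if "j \<in> {1..?s}" for j
    using cross assms(9) that unfolding fesd_cross_complementarity_def by blast
  \<comment> \<open>Component \<open>k\<close> leaves the active set across the junction: the
    constraint value vanishes by a condition inside element \<open>n - 1\<close>, the multiplier by
    one reaching back from element \<open>n\<close>.\<close>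
  have activation_end: "c (X (n - 1) ?s) $ k = 0 \<and> L (n - 1) ?s $ k = 0"
    if "i \<in> {1..?s}" "j \<in> {1..?s}" "L (n - 1) i $ k > 0" "c (X n j) $ k > 0" for i j k
    using complementary_left_eq_0[OF within[OF s that(1)] that(3)]
      complementary_right_eq_0[OF backward[OF that(2)] that(4)] ..
  \<comment> \<open>Component \<open>k\<close> becomes active, and the sources swap: element
    \<open>n\<close> now controls the constraint value, element \<open>n - 1\<close> the
    multiplier.\<close>
  have activation_start: "c (X (n - 1) ?s) $ k = 0 \<and> L (n - 1) ?s $ k = 0"
    if "i \<in> {1..?s}" "j \<in> {1..?s}" "c (X (n - 1) i) $ k > 0" "L n j $ k > 0" for i j k
    using complementary_left_eq_0[OF forward[OF that(2)] that(4)]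
      complementary_right_eq_0[OF within[OF that(1) s] that(3)] ..
  \<comment> \<open>Strongly active indices supply the positive multiplier and inactive ones the
    positive constraint value, so each inclusion reduces to its pointwise form.\<close>
  show ?thesis
    unfolding strongly_active_def weakly_active_def inactive_def
    using activation_end activation_start by blast
qed

end
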